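(* Let $M$ be a matroid on the ground set $[n]=\{x_1,\ldots,x_n\}$. Then $M$ satisfies White's conjecture if and only if the contraction $\overline{M}$ of $M$ satisfies White's conjecture.
   Context: A matroid $M$ is a finite ground set $\mathcal{E}_M$ with a non-empty family $\mathcal{B}_M$ of bases satisfying the exchange property. Contraction (not the usual matroid minor operation): let $M$ be a matroid on $[n]=\{x_1,\ldots,x_n\}$ with basis set $\mathcal{B}$. Define an equivalence relation on $[n]$ by $x_i\sim x_j$ if and only if $\{A\setminus x_i:A\in\mathcal{B},x_i\in A\}=\{A\setminus x_j:A\in\mathcal{B},x_j\in A\}$. Let $y_1,\ldots,y_m$ be the equivalence classes. For $A\in\mathcal{B}$ let $\overline{A}=\{y_i:y_i\cap A\ne\emptyset\}$. The contraction $\overline{M}$ is the matroid with ground set $\{y_1,\ldots,y_m\}$ and basis set $\{\overline{A}:A\in\mathcal{B}\}$ (this is known to be a matroid). Two sequences of bases $(A_1,\ldots,A_m)$ and $(B_1,\ldots,B_m)$ of a matroid $M$ are compatible if $A_1\cup\cdots\cup A_m=B_1\cup\cdots\cup B_m$ as multisets. Let $1\le r<s\le m$. If $x\in A_r$ and $y\in A_s$ are such that $(A_r\setminus x)\cup y$ and $(A_s\setminus y)\cup x$ are both bases, then replacing $A_r$ by $(A_r\setminus x)\cup y$ and $A_s$ by $(A_s\setminus y)\cup x$ in $(A_1,\ldots,A_m)$ is a symmetric exchange. If $U\subseteq A_r$ and $V\subseteq A_s$ are such that $(A_r\setminus U)\cup V$ and $(A_s\setminus V)\cup U$ are both bases,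 then replacing $A_r$ by $(A_r\setminus U)\cup V$ and $A_s$ by $(A_s\setminus V)\cup U$ is a symmetric subset exchange. Write $\sim^1_M$ for the relation "is obtained by a symmetric exchange", $\sim^2_M$ for "is obtained by a symmetric exchange or by a permutation of the order of the bases", and $\sim^3_M$ for "is obtained by a symmetric subset exchange". For $i=1,2,3$, $\mathrm{TE}(i)$ is the class of matroids $M$ such that, for every $m\ge 1$, any two compatible sequences of $m$ bases of $M$ are connected by a finite (possibly empty) chain of $\sim^i_M$ steps through sequences of $m$ bases of $M$. A matroid $M$ satisfies White's conjecture if $M\in\mathrm{TE}(i)$ for all $i=1,2,3$. *)

theory Defs
  imports "HOL-Library.Multiset"
begin

record 'a basis_system =
  ground :: "'a set"
  bases :: "'a set set"

definition matroid :: "'a basis_system \<Rightarrow> bool" where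
  "matroid M \<longleftrightarrow>
     finite (ground M) \<and>
     bases M \<subseteq> Pow (ground M) \<and>
     bases M \<noteq> {} \<and>
     (\<forall>A\<in>bases M. \<forall>B\<in>bases M. \<forall>x\<in>A - B. \<exists>y\<in>B - A. (A - {x}) \<union> {y} \<in> bases M)"


text \<open>
  This is not the usual minor operation: it identifies parallel elements. The elements of the
  ground set lying in no basis, if there are any, form a single class, which lies in no basis of
  the contraction.
\<close>

definition link :: "'a basis_system \<Rightarrow> 'a \<Rightarrow> 'a set set" where
  "link M x = {A - {x} | A. A \<in> bases M \<and> x \<in> A}"

definition link_rel :: "'a basis_system \<Rightarrow> ('a \<times> 'a) set" where
  "link_rel M = {(x, y). x \<in> ground M \<and> y \<in> ground M \<and> link M x = link M y}"

definition class_image :: "'a basis_system \<Rightarrow> 'a set \<Rightarrow> 'a set set" where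
  "class_image M A = {Y \<in> ground M // link_rel M. Y \<inter> A \<noteq> {}}"

definition contraction :: "'a basis_system \<Rightarrow> 'a set basis_system" where
  "contraction M =
     \<lparr>ground = ground M // link_rel M, bases = class_image M ` bases M\<rparr>"

lemma equiv_link_rel: "equiv (ground M) (link_rel M)"
  by (rule equivI) (auto simp: link_rel_def refl_on_def sym_on_def trans_on_def)

lemma basis_link_rel_eq:
  assumes "A \<in> bases M" "x \<in> A" "y \<in> A" "(x, y) \<in> link_rel M"
  shows "x = y"
proof (rule ccontr)
  assume "x \<noteq> y"
  have "A - {x} \<in> link M y"
    using assms by (auto simp: link_rel_def link_def)
  with \<open>x \<noteq> y\<close> \<open>y \<in> A\<close> show False by (auto simp: link_def)
qed

lemma matroid_contraction:
  assumes "matroid M"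
  shows "matroid (contraction M)"
proof -
  let ?R = "link_rel M"
  let ?c = "\<lambda>x. ?R `` {x}"
  have sub: "A \<subseteq> ground M" if "A \<in> bases M" for A
    using assms that by (auto simp: matroid_def)
  have img: "class_image M A = ?c ` A" if "A \<in> bases M" for A
  proof -
    have "Y \<in> ?c ` A" if Y: "Y \<in> ground M // ?R" and x: "x \<in> Y" "x \<in> A" for Y x
    proof -
      obtain w where w: "Y = ?c w" using Y by (rule quotientE)
      then have "?c w = ?c x" using x equiv_class_eq[OF equiv_link_rel] by simp
      with w x show ?thesis by simp
    qed
    moreover have "?c x \<in> ground M // ?R \<and> ?c x \<inter> A \<noteq> {}" if "x \<in> A" for x
    proof -
      have x: "x \<in> ground M" using that sub[OF \<open>A \<in> bases M\<close>] by auto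
      then have "x \<in> ?c x" by (rule equiv_class_self[OF equiv_link_rel])
      with x that show ?thesis by (auto intro: quotientI)
    qed
    ultimately show ?thesis unfolding class_image_def by fast
  qed
  have eqI: "x = y" if "A \<in> bases M" "x \<in> A" "y \<in> A" "?c x = ?c y" for A x y
  proof -
    have "y \<in> ground M" using that sub by auto
    then have "(x, y) \<in> ?R" by (rule eq_equiv_class[OF that(4) equiv_link_rel])
    then show ?thesis by (rule basis_link_rel_eq[OF that(1-3)])
  qed
  have "\<exists>Z\<in>class_image M B - class_image M A.
          (class_image M A - {Y}) \<union> {Z} \<in> class_image M ` bases M"
    if A: "A \<in> bases M" and B: "B \<in> bases M" and Y: "Y \<in> class_image M A - class_image M B"
    for A B Y
  proof -
    obtain x where x: "x \<in> A" "Y = ?c x" using Y unfolding img[OF A] by fast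
    have "x \<notin> B" using Y x(2) unfolding img[OF B] by fast
    with x(1) have "x \<in> A - B" by simp
    moreover have "\<forall>A\<in>bases M. \<forall>B\<in>bases M. \<forall>x\<in>A - B. \<exists>y\<in>B - A. (A - {x}) \<union> {y} \<in> bases M"
      using assms unfolding matroid_def by (elim conjE)
    ultimately have "\<exists>z\<in>B - A. (A - {x}) \<union> {z} \<in> bases M" using A B by blast
    then obtain z where z: "z \<in> B" "z \<notin> A" and C: "(A - {x}) \<union> {z} \<in> bases M"
      by blast
    have nz: "?c z \<notin> ?c ` A"
    proof
      assume "?c z \<in> ?c ` A"
      then obtain w where w: "w \<in> A" "?c z = ?c w" by auto
      have "?c z \<in> class_image M B" unfolding img[OF B] using z(1) by (rule imageI)
      with w x Y have "w \<noteq> x" by auto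
      with w have "w \<in> (A - {x}) \<union> {z}" by simp
      then have "z = w" by (intro eqI[OF C _ _ w(2)]) simp_all
      with w z show False by simp
    qed
    have "?c ` (A - {x}) = ?c ` A - {Y}"
    proof -
      have "?c v \<noteq> Y" if "v \<in> A - {x}" for v
      proof
        assume "?c v = Y"
        then have "v = x" using that x by (intro eqI[OF A]) simp_all
        with that show False by simp
      qed
      with x(2) show ?thesis by fast
    qed
    then have eq: "class_image M ((A - {x}) \<union> {z}) = (class_image M A - {Y}) \<union> {?c z}"
      unfolding img[OF A] img[OF C] by (simp only: image_Un image_insert image_empty)
    have "?c z \<in> class_image M B - class_image M A"
      using nz z unfolding img[OF A] img[OF B] by simp
    moreover have "(class_image M A - {Y}) \<union> {?c z} \<in> class_image M ` bases M"
      unfolding eq[symmetric] using C by (rule imageI)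
    ultimately show ?thesis by blast
  qed
  moreover have "finite (ground M // ?R)"
    using assms by (auto simp: matroid_def link_rel_def intro!: finite_quotient)
  moreover have "bases M \<noteq> {}" using assms by (simp add: matroid_def)
  moreover have "class_image M ` bases M \<subseteq> Pow (ground M // ?R)"
    unfolding class_image_def by blast
  ultimately show ?thesis
    unfolding matroid_def contraction_def by simp
qed


definition basis_seq :: "'a basis_system \<Rightarrow> nat \<Rightarrow> 'a set list \<Rightarrow> bool" where
  "basis_seq M m As \<longleftrightarrow> length As = m \<and> set As \<subseteq> bases M"

definition compatible :: "'a set list \<Rightarrow> 'a set list \<Rightarrow> bool" where
  "compatible As Bs \<longleftrightarrow> (\<Sum>A\<leftarrow>As. mset_set A) = (\<Sum>B\<leftarrow>Bs. mset_set B)"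

definition sym_exchange :: "'a basis_system \<Rightarrow> 'a set list \<Rightarrow> 'a set list \<Rightarrow> bool" where
  "sym_exchange M As Bs \<longleftrightarrow>
     (\<exists>r s x y. r < s \<and> s < length As \<and> x \<in> As ! r \<and> y \<in> As ! s \<and>
        (As ! r - {x}) \<union> {y} \<in> bases M \<and> (As ! s - {y}) \<union> {x} \<in> bases M \<and>
        Bs = As[r := (As ! r - {x}) \<union> {y}, s := (As ! s - {y}) \<union> {x}])"

definition sym_exchange_or_perm :: "'a basis_system \<Rightarrow> 'a set list \<Rightarrow> 'a set list \<Rightarrow> bool" where
  "sym_exchange_or_perm M As Bs \<longleftrightarrow> sym_exchange M As Bs \<or> mset As = mset Bs"

definition sym_subset_exchange :: "'a basis_system \<Rightarrow> 'a set list \<Rightarrow> 'a set list \<Rightarrow> bool" where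
  "sym_subset_exchange M As Bs \<longleftrightarrow>
     (\<exists>r s U V. r < s \<and> s < length As \<and> U \<subseteq> As ! r \<and> V \<subseteq> As ! s \<and>
        (As ! r - U) \<union> V \<in> bases M \<and> (As ! s - V) \<union> U \<in> bases M \<and>
        Bs = As[r := (As ! r - U) \<union> V, s := (As ! s - V) \<union> U])"

text \<open>
  The classes TE(1), TE(2), TE(3) are obtained by taking the step relation to be, respectively,
  \<open>sym_exchange\<close>, \<open>sym_exchange_or_perm\<close> and \<open>sym_subset_exchange\<close>.
\<close>

definition TE :: "('a basis_system \<Rightarrow> 'a set list \<Rightarrow> 'a set list \<Rightarrow> bool) \<Rightarrow> 'a basis_system set" where
  "TE step = {M. matroid M \<and>
     (\<forall>m\<ge>1. \<forall>As Bs. basis_seq M m As \<and> basis_seq M m Bs \<and> compatible As Bs \<longrightarrow>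
        (\<lambda>Xs Ys. basis_seq M m Xs \<and> basis_seq M m Ys \<and> step M Xs Ys)\<^sup>*\<^sup>* As Bs)}"

definition satisfies_white :: "'a basis_system \<Rightarrow> bool" where
  "satisfies_white M \<longleftrightarrow>
     M \<in> TE sym_exchange \<and> M \<in> TE sym_exchange_or_perm \<and> M \<in> TE sym_subset_exchange"

end

theory Submission
  imports Defs
begin

text \<open>
  The bases of \<open>M\<close> are exactly the transversals of the bases of the contraction. Hence exchanges
  project to the contraction, and exchanges of the contraction lift. Lifting a chain between the
  projections of two compatible sequences reaches a sequence that agrees with the target up to
  swapping equivalent elements, and each such swap is itself a symmetric exchange. In the other
  direction, a choice of representatives embeds the contraction into \<open>M\<close>.
\<close>

section \<open>Matroid bases: exchange, equicardinality and disjointness\<close>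

lemma matroid_exchange:
  assumes "matroid M" "A \<in> bases M" "B \<in> bases M" "x \<in> A - B"
  obtains y where "y \<in> B - A" "(A - {x}) \<union> {y} \<in> bases M"
proof -
  have "\<forall>A\<in>bases M. \<forall>B\<in>bases M. \<forall>x\<in>A - B. \<exists>y\<in>B - A. (A - {x}) \<union> {y} \<in> bases M"
    using assms(1) unfolding matroid_def by (elim conjE)
  with assms(2-4) have "\<exists>y\<in>B - A. (A - {x}) \<union> {y} \<in> bases M" by (elim ballE) auto
  then show ?thesis using that by (elim bexE)
qed

lemma basis_subset: "matroid M \<Longrightarrow> A \<in> bases M \<Longrightarrow> A \<subseteq> ground M"
  by (auto simp: matroid_def)

lemma finite_basis: "matroid M \<Longrightarrow> A \<in> bases M \<Longrightarrow> finite A"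
  using basis_subset finite_subset unfolding matroid_def by metis

text \<open>Each exchange moves \<open>A\<close> towards \<open>B\<close> without changing its size,
  so induction on the size of \<open>A - B\<close> reduces to the case where \<open>A\<close> is
  contained in \<open>B\<close>.\<close>

lemma card_bases_eq:
  assumes M: "matroid M" and "A \<in> bases M" "B \<in> bases M"
  shows "card A = card B"
  using assms(2)
proof (induction "card (A - B)" arbitrary: A rule: less_induct)
  case less
  have fin: "finite A" using finite_basis[OF M less.prems] .
  show ?case
  proof (cases "A - B = {}")
    case True
    \<comment> \<open>An element of \<open>B - A\<close> would have to be exchanged for one of
      \<open>A - B\<close>, which is empty.\<close>
    then have "B - A = {}"
      using matroid_exchange[OF M assms(3) less.prems] by (metis all_not_in_conv)
    with True show ?thesis by (metis Diff_eq_empty_iff subset_antisym)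
  next
    case False
    then obtain x where x: "x \<in> A - B" by blast
    then obtain y where y: "y \<in> B - A" and C: "(A - {x}) \<union> {y} \<in> bases M"
      using matroid_exchange[OF M less.prems assms(3)] by metis
    have "(A - {x}) \<union> {y} - B = (A - B) - {x}" using y by blast
    then have "card ((A - {x}) \<union> {y} - B) < card (A - B)"
      using x fin by (metis card_Diff1_less finite_Diff)
    from less.hyps[OF this C] have "card ((A - {x}) \<union> {y}) = card B" .
    moreover have "card ((A - {x}) \<union> {y}) = card A"
      using x y fin card_Suc_Diff1[of A x] by auto
    ultimately show ?thesis by simp
  qed
qed

text \<open>
  Nothing in the definition of an exchange forbids overlaps; equicardinality of bases does.
\<close>

lemma exchange_disjoint:
  assumes M: "matroid M" and A: "A \<in> bases M" and B: "B \<in> bases M"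
    and U: "U \<subseteq> A" and V: "V \<subseteq> B"
    and A': "(A - U) \<union> V \<in> bases M" and B': "(B - V) \<union> U \<in> bases M"
  shows "(A - U) \<inter> V = {}" "(B - V) \<inter> U = {}"
proof -
  have fin: "finite A" "finite B" "finite U" "finite V"
    using finite_basis[OF M] A B U V by (auto intro: finite_subset)
  have "card ((A - U) \<union> V) + card ((A - U) \<inter> V) = card (A - U) + card V"
    using fin by (intro card_Un_Int[symmetric]) auto
  moreover have "card ((B - V) \<union> U) + card ((B - V) \<inter> U) = card (B - V) + card U"
    using fin by (intro card_Un_Int[symmetric]) auto
  moreover have "card (A - U) = card A - card U" "card U \<le> card A"
    using U fin by (simp_all add: card_Diff_subset card_mono)
  moreover have "card (B - V) = card B - card V" "card V \<le> card B"
    using V fin by (simp_all add: card_Diff_subset card_mono)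
  moreover have "card ((A - U) \<union> V) = card A" "card ((B - V) \<union> U) = card A" "card B = card A"
    using card_bases_eq[OF M] A B A' B' by metis+
  \<comment> \<open>The first overlap has size \<open>card V - card U\<close> and the second has the
    negative of this, so both are zero.\<close>
  ultimately have "card ((A - U) \<inter> V) = 0" "card ((B - V) \<inter> U) = 0" by linarith+
  then show "(A - U) \<inter> V = {}" "(B - V) \<inter> U = {}" using fin by auto
qed

text \<open>Disjointness turns the unions into multiset sums; both sides then consist of
  \<open>A - U\<close>, \<open>U\<close>, \<open>B - V\<close> and \<open>V\<close>.\<close>

lemma mset_set_exchange:
  assumes "finite A" "finite B" "U \<subseteq> A" "V \<subseteq> B" "(A - U) \<inter> V = {}" "(B - V) \<inter> U = {}"
  shows "mset_set ((A - U) \<union> V) + mset_set ((B - V) \<union> U) = mset_set A + mset_set B"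
proof -
  have fin: "finite U" "finite V" using assms by (auto intro: finite_subset)
  have "mset_set A = mset_set (A - U) + mset_set U"
    using assms fin by (metis mset_set_Union Diff_disjoint Int_commute Un_Diff_cancel2 finite_Diff
        sup.absorb1)
  moreover have "mset_set B = mset_set (B - V) + mset_set V"
    using assms fin by (metis mset_set_Union Diff_disjoint Int_commute Un_Diff_cancel2 finite_Diff
        sup.absorb1)
  ultimately show ?thesis using assms fin by (simp add: mset_set_Union)
qed

section \<open>Multiset unions of sequences and compatibility\<close>

lemma sum_list_map_update:
  fixes f :: "'b \<Rightarrow> 'c::comm_monoid_add"
  shows "r < length xs \<Longrightarrow>
    sum_list (map f (xs[r := a])) + f (xs ! r) = sum_list (map f xs) + f a"
proof (induction xs arbitrary: r)
  case (Cons x xs)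
  show ?case
  proof (cases r)
    case (Suc r')
    then show ?thesis using Cons.IH[of r'] Cons.prems by (simp add: add.assoc)
  qed (simp add: ac_simps)
qed simp

text \<open>The two single-entry updates are balanced one after the other; the totals of the old and
  the new pair agree and cancel.\<close>

lemma compatible_update2:
  assumes "r \<noteq> s" "r < length As" "s < length As"
    and "mset_set A + mset_set B = mset_set (As ! r) + mset_set (As ! s)"
  shows "compatible As (As[r := A, s := B])"
proof -
  let ?S = "\<lambda>As. sum_list (map mset_set As)"
  have "?S (As[r := A]) + mset_set (As ! r) = ?S As + mset_set A"
    using assms by (intro sum_list_map_update)
  moreover have "?S (As[r := A, s := B]) + mset_set (As ! s) = ?S (As[r := A]) + mset_set B"
    using assms sum_list_map_update[of s "As[r := A]" mset_set B] by simp
  ultimately have "?S (As[r := A, s := B]) + (mset_set (As ! r) + mset_set (As ! s))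
      = ?S As + (mset_set A + mset_set B)"
    by (metis (no_types, lifting) add.assoc add.commute)
  then show ?thesis unfolding compatible_def assms(4) by simp
qed

lemma compatible_trans: "compatible As Bs \<Longrightarrow> compatible Bs Cs \<Longrightarrow> compatible As Cs"
  and compatible_sym: "compatible As Bs \<Longrightarrow> compatible Bs As"
  by (simp_all add: compatible_def)

lemma compatible_if_mset_eq:
  assumes "mset As = mset Bs"
  shows "compatible As Bs"
proof -
  have "sum_mset (mset (map mset_set As)) = sum_mset (mset (map mset_set Bs))"
    using assms by simp
  then show ?thesis unfolding compatible_def sum_mset_sum_list .
qed

text \<open>Injectivity on each entry lets \<open>image_mset f\<close> commute with
  \<open>mset_set\<close>, so the common multiset union is carried over as a whole.\<close>

lemma compatible_map_image:
  assumes "compatible As Bs" "\<And>A. A \<in> set As \<union> set Bs \<Longrightarrow> inj_on f A"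
  shows "compatible (map ((`) f) As) (map ((`) f) Bs)"
proof -
  have *: "image_mset f (sum_list (map mset_set As)) = sum_list (map mset_set (map ((`) f) As))"
    if "\<And>A. A \<in> set As \<Longrightarrow> inj_on f A" for As
    using that by (induction As) (auto simp: image_mset_mset_set)
  show ?thesis
    using assms *[of As] *[of Bs] unfolding compatible_def by auto
qed

text \<open>Compatible sequences contain \<open>x\<close> equally often, so a position where
  \<open>As\<close> lacks an \<open>x\<close> of \<open>Bs\<close> is balanced by one where
  \<open>As\<close> has an extra \<open>x\<close>.\<close>

lemma compatible_missing_elem:
  assumes "compatible As Bs" "length As = length Bs"
    and "\<And>A. A \<in> set As \<union> set Bs \<Longrightarrow> finite A"
    and "r < length As" "x \<in> Bs ! r - As ! r"
  obtains s where "s < length As" "x \<in> As ! s - Bs ! s"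
proof -
  \<comment> \<open>The multiplicity of \<open>x\<close> is the number of positions whose set
    contains it. Finiteness matters, as \<open>mset_set\<close> of an infinite set is empty.\<close>
  have cnt: "count (sum_list (map mset_set As)) x = (\<Sum>i<length As. of_bool (x \<in> As ! i))"
    if "\<And>A. A \<in> set As \<Longrightarrow> finite A" for As
  proof -
    have "count (sum_list (map mset_set As)) x = sum_list (map (\<lambda>A. count (mset_set A) x) As)"
      by (induction As) auto
    also have "\<dots> = (\<Sum>i<length As. count (mset_set (As ! i)) x)"
      by (simp add: sum_list_sum_nth atLeast0LessThan)
    also have "\<dots> = (\<Sum>i<length As. of_bool (x \<in> As ! i))"
      using that by (intro sum.cong) (auto simp: count_mset_set')
    finally show ?thesis .
  qed
  have eq: "(\<Sum>i<length As. of_bool (x \<in> As ! i)) = (\<Sum>i<length As. of_bool (x \<in> Bs ! i) :: nat)"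
    using assms(1-3) cnt[of As] cnt[of Bs] by (simp add: compatible_def)
  have "\<exists>s<length As. x \<in> As ! s - Bs ! s"
  proof (rule ccontr)
    assume "\<not> ?thesis"
    then have "(\<Sum>i<length As. of_bool (x \<in> As ! i)) < (\<Sum>i<length As. of_bool (x \<in> Bs ! i) :: nat)"
      using assms(4,5) by (intro sum_strict_mono_ex1) (auto intro!: bexI[of _ r])
    with eq show False by simp
  qed
  then show ?thesis using that by blast
qed

text \<open>Lets a reordering of the projected sequence be realised by a reordering of the original
  one: each entry of \<open>Cs\<close> in turn picks a preimage not yet used.\<close>

lemma mset_map_eq_lift:
  "mset (map f As) = mset Cs \<Longrightarrow> \<exists>Bs. mset As = mset Bs \<and> map f Bs = Cs"
proof (induction Cs arbitrary: As)
  case Nil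
  then show ?case by simp
next
  case (Cons C Cs)
  then have "C \<in> set (map f As)" by (metis list.set_intros(1) set_mset_mset)
  then obtain a where a: "a \<in> set As" "C = f a" by auto
  from split_list[OF a(1)] obtain ys zs where As: "As = ys @ a # zs" by blast
  with Cons.prems a(2) have "mset (map f (ys @ zs)) = mset Cs" by simp
  from Cons.IH[OF this] obtain Bs where "mset (ys @ zs) = mset Bs" "map f Bs = Cs" by blast
  then show ?case using As a(2) by (intro exI[of _ "a # Bs"]) simp
qed

section \<open>Exchange steps on sequences of bases\<close>

text \<open>The order of the two positions is immaterial, since exchanging the roles of
  \<open>x\<close> and \<open>y\<close> exchanges those of \<open>r\<close> and
  \<open>s\<close>.\<close>

lemma sym_exchangeI:
  assumes "r \<noteq> s" "r < length As" "s < length As" "x \<in> As ! r" "y \<in> As ! s"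
    and "(As ! r - {x}) \<union> {y} \<in> bases M" "(As ! s - {y}) \<union> {x} \<in> bases M"
    and "Bs = As[r := (As ! r - {x}) \<union> {y}, s := (As ! s - {y}) \<union> {x}]"
  shows "sym_exchange M As Bs"
proof (cases "r < s")
  case True
  with assms show ?thesis unfolding sym_exchange_def by blast
next
  case False
  then have "s < r" using assms(1) by simp
  with assms show ?thesis unfolding sym_exchange_def
    by (intro exI[of _ s] exI[of _ r] exI[of _ y] exI[of _ x]) (simp add: list_update_swap)
qed

lemma sym_exchange_imp_subset: "sym_exchange M As Bs \<Longrightarrow> sym_subset_exchange M As Bs"
proof -
  assume "sym_exchange M As Bs"
  then obtain r s x y where "r < s" "s < length As" "x \<in> As ! r" "y \<in> As ! s"
    "(As ! r - {x}) \<union> {y} \<in> bases M" "(As ! s - {y}) \<union> {x} \<in> bases M"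
    "Bs = As[r := (As ! r - {x}) \<union> {y}, s := (As ! s - {y}) \<union> {x}]"
    unfolding sym_exchange_def by blast
  then show ?thesis unfolding sym_subset_exchange_def
    by (intro exI[of _ r] exI[of _ s] exI[of _ "{x}"] exI[of _ "{y}"]) simp
qed

lemma basis_seq_nth: "basis_seq M m As \<Longrightarrow> i < m \<Longrightarrow> As ! i \<in> bases M"
  by (auto simp: basis_seq_def)

lemma basis_seq_update2:
  "basis_seq M m As \<Longrightarrow> A \<in> bases M \<Longrightarrow> B \<in> bases M \<Longrightarrow> basis_seq M m (As[r := A, s := B])"
  unfolding basis_seq_def by (intro conjI set_update_subsetI) auto

section \<open>Equivalence classes and transversals\<close>

context
  fixes M :: "'a basis_system"
  assumes M: "matroid M"
begin

abbreviation (input) cls :: "'a \<Rightarrow> 'a set" where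
  "cls x \<equiv> link_rel M `` {x}"

lemma cls_eq_iff: "x \<in> ground M \<Longrightarrow> y \<in> ground M \<Longrightarrow> cls x = cls y \<longleftrightarrow> link M x = link M y"
  by (subst eq_equiv_class_iff[OF equiv_link_rel]) (auto simp: link_rel_def)

lemma class_image_eq:
  assumes "A \<subseteq> ground M"
  shows "class_image M A = cls ` A"
proof -
  have "Y \<in> cls ` A" if Y: "Y \<in> ground M // link_rel M" "Y \<inter> A \<noteq> {}" for Y
  proof -
    from Y obtain w x where "Y = cls w" "x \<in> Y" "x \<in> A" by (auto elim!: quotientE)
    then have "Y = cls x" using equiv_class_eq[OF equiv_link_rel] by simp
    with \<open>x \<in> A\<close> show ?thesis by blast
  qed
  moreover have "cls x \<in> ground M // link_rel M" "cls x \<inter> A \<noteq> {}" if "x \<in> A" for x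
    using that assms equiv_class_self[OF equiv_link_rel, of x M] by (auto intro: quotientI)
  ultimately show ?thesis unfolding class_image_def by fast
qed

lemma bases_contraction: "bases (contraction M) = (\<lambda>A. cls ` A) ` bases M"
  unfolding contraction_def
  using class_image_eq[OF basis_subset[OF M]] by simp

lemma inj_on_cls:
  assumes "A \<in> bases M"
  shows "inj_on cls A"
proof (rule inj_onI)
  fix x y assume xy: "x \<in> A" "y \<in> A" "cls x = cls y"
  then have "y \<in> ground M" using basis_subset[OF M assms] by auto
  from eq_equiv_class[OF xy(3) equiv_link_rel this] show "x = y"
    by (rule basis_link_rel_eq[OF assms xy(1,2)])
qed

text \<open>\<open>A - {x}\<close> lies in the link of \<open>x\<close>, which is also the link of
  \<open>t\<close>, so adding \<open>t\<close> to it gives a basis.\<close>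

lemma basis_replace_equivalent:
  assumes "A \<in> bases M" "x \<in> A" "t \<in> ground M" "cls t = cls x"
  shows "(A - {x}) \<union> {t} \<in> bases M"
proof -
  have "link M x = link M t"
    using assms basis_subset[OF M assms(1)] cls_eq_iff[of t x] by auto
  moreover have "A - {x} \<in> link M x" using assms by (auto simp: link_def)
  ultimately obtain A' where "A - {x} = A' - {t}" "A' \<in> bases M" "t \<in> A'"
    by (auto simp: link_def)
  moreover from this have "(A - {x}) \<union> {t} = A'" by blast
  ultimately show ?thesis by simp
qed

text \<open>Some basis \<open>A\<close> meets the same classes as \<open>T\<close>. Replacing its
  elements outside \<open>T\<close> one by one by equivalent elements of \<open>T\<close> keeps it a
  basis with these classes, until \<open>A\<close> lies inside \<open>T\<close>; injectivity then
  forces equality.\<close>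

lemma transversal_basis:
  assumes T: "T \<subseteq> ground M" "inj_on cls T" and "cls ` T \<in> bases (contraction M)"
  shows "T \<in> bases M"
proof -
  have "cls ` T = cls ` A \<Longrightarrow> A \<in> bases M \<Longrightarrow> T \<in> bases M" for A
  proof (induction "card (A - T)" arbitrary: A rule: less_induct)
    case less
    show ?case
    proof (cases "A \<subseteq> T")
      case True
      then have "T = A" using T(2) less.prems(1) by (metis inj_on_image_eq_iff order_refl)
      with less.prems show ?thesis by simp
    next
      case False
      then obtain x where x: "x \<in> A" "x \<notin> T" by blast
      then have "cls x \<in> cls ` T" unfolding less.prems(1) by blast
      then obtain t where t: "cls x = cls t" "t \<in> T" by (rule imageE)
      let ?A = "(A - {x}) \<union> {t}"
      have "?A \<in> bases M"
        using x(1) t(2) T(1) by (intro t(1)[symmetric] basis_replace_equivalent less.prems(2)) auto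
      moreover have "cls ` ?A = cls ` A"
      proof -
        have "A = (A - {x}) \<union> {x}" using x by blast
        from arg_cong[OF this, of "image cls"] show ?thesis
          unfolding image_Un image_insert image_empty t(1) by simp
      qed
      moreover have "?A - T = (A - T) - {x}" using t(2) by blast
      then have "card (?A - T) < card (A - T)"
        using x finite_basis[OF M less.prems(2)] by (metis DiffI card_Diff1_less finite_Diff)
      ultimately show ?thesis using less.hyps less.prems(1) by presburger
    qed
  qed
  with assms(3) show ?thesis unfolding bases_contraction by blast
qed

section \<open>Projecting and lifting exchanges\<close>

text \<open>A basis has at most one element in each class, so on it taking classes commutes with set
  difference.\<close>

lemma cls_image_exchange:
  assumes "A \<in> bases M" "U \<subseteq> A"
  shows "cls ` ((A - U) \<union> V) = (cls ` A - cls ` U) \<union> cls ` V"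
proof -
  have "cls ` (A - U) = cls ` A - cls ` U"
    using inj_on_image_set_diff[OF inj_on_cls[OF assms(1)], of A U] assms(2) by auto
  then show ?thesis by (simp only: image_Un)
qed

text \<open>Stated for subsets to serve both kinds of exchange: single exchanges are the case of
  singletons.\<close>

lemma project_subset_exchange:
  assumes As: "basis_seq M m As" and rs: "r < s" "s < length As"
    and UV: "U \<subseteq> As ! r" "V \<subseteq> As ! s"
    and A': "(As ! r - U) \<union> V \<in> bases M" and B': "(As ! s - V) \<union> U \<in> bases M"
  defines "As' \<equiv> map ((`) cls) As"
  shows "cls ` U \<subseteq> As' ! r" "cls ` V \<subseteq> As' ! s"
    "(As' ! r - cls ` U) \<union> cls ` V \<in> bases (contraction M)"
    "(As' ! s - cls ` V) \<union> cls ` U \<in> bases (contraction M)"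
    "map ((`) cls) (As[r := (As ! r - U) \<union> V, s := (As ! s - V) \<union> U])
     = As'[r := (As' ! r - cls ` U) \<union> cls ` V, s := (As' ! s - cls ` V) \<union> cls ` U]"
proof -
  have "As ! r \<in> bases M" "As ! s \<in> bases M"
    using basis_seq_nth[OF As] rs As by (auto simp: basis_seq_def)
  from this[THEN cls_image_exchange] UV
  have eq: "cls ` ((As ! r - U) \<union> V) = (As' ! r - cls ` U) \<union> cls ` V"
    "cls ` ((As ! s - V) \<union> U) = (As' ! s - cls ` V) \<union> cls ` U"
    using rs by (simp_all add: As'_def)
  show "cls ` U \<subseteq> As' ! r" "cls ` V \<subseteq> As' ! s"
    using UV rs by (auto simp: As'_def)
  show "(As' ! r - cls ` U) \<union> cls ` V \<in> bases (contraction M)"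
    "(As' ! s - cls ` V) \<union> cls ` U \<in> bases (contraction M)"
    unfolding eq[symmetric] bases_contraction using A' B' by blast+
  show "map ((`) cls) (As[r := (As ! r - U) \<union> V, s := (As ! s - V) \<union> U])
     = As'[r := (As' ! r - cls ` U) \<union> cls ` V, s := (As' ! s - cls ` V) \<union> cls ` U]"
    unfolding map_update eq As'_def ..
qed

text \<open>The new sets have the right classes; they are bases by \<open>transversal_basis\<close>
  once no class is met twice.\<close>

lemma lift_subset_exchange:
  assumes A: "A \<in> bases M" and B: "B \<in> bases M" and U: "U \<subseteq> A" and V: "V \<subseteq> B"
    and A': "(cls ` A - cls ` U) \<union> cls ` V \<in> bases (contraction M)"
    and B': "(cls ` B - cls ` V) \<union> cls ` U \<in> bases (contraction M)"
  shows "(A - U) \<union> V \<in> bases M" "(B - V) \<union> U \<in> bases M"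
    "mset_set ((A - U) \<union> V) + mset_set ((B - V) \<union> U) = mset_set A + mset_set B"
proof -
  note gr = basis_subset[OF M A] basis_subset[OF M B]
  note inj = inj_on_cls[OF A] inj_on_cls[OF B]
  have "cls ` A \<in> bases (contraction M)" "cls ` B \<in> bases (contraction M)"
    using A B unfolding bases_contraction by blast+
  \<comment> \<open>Equicardinality of bases is applied in the contraction, where it shows that
    incoming and remaining elements never share a class.\<close>
  from exchange_disjoint[OF matroid_contraction[OF M] this image_mono[OF U] image_mono[OF V] A' B']
  have disj: "cls ` (A - U) \<inter> cls ` V = {}" "cls ` (B - V) \<inter> cls ` U = {}"
    using inj_on_image_set_diff[OF inj(1), of A U] inj_on_image_set_diff[OF inj(2), of B V] U V
    by auto
  have *: "inj_on cls (X \<union> Y)"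
    if "inj_on cls X" "inj_on cls Y" "cls ` X \<inter> cls ` Y = {}" for X Y
    using that unfolding inj_on_Un by blast
  have "inj_on cls ((A - U) \<union> V)" "inj_on cls ((B - V) \<union> U)"
    by (intro * disj inj_on_subset[OF inj(1)] inj_on_subset[OF inj(2)]; use U V in blast)+
  moreover have "(A - U) \<union> V \<subseteq> ground M" "(B - V) \<union> U \<subseteq> ground M" using gr U V by blast+
  ultimately show new: "(A - U) \<union> V \<in> bases M" "(B - V) \<union> U \<in> bases M"
    using A' B' cls_image_exchange[OF A U] cls_image_exchange[OF B V]
    by (metis transversal_basis)+
  show "mset_set ((A - U) \<union> V) + mset_set ((B - V) \<union> U) = mset_set A + mset_set B"
    using exchange_disjoint[OF M A B U V new] finite_basis[OF M] A B U V
    by (intro mset_set_exchange)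
qed

lemma lift_subset_exchange_seq:
  assumes As: "basis_seq M m As" and rs: "r < s" "s < length As"
    and U: "U \<subseteq> As ! r" and V: "V \<subseteq> As ! s"
  defines "As' \<equiv> map ((`) cls) As"
    and "Bs \<equiv> As[r := (As ! r - U) \<union> V, s := (As ! s - V) \<union> U]"
  assumes A': "(As' ! r - cls ` U) \<union> cls ` V \<in> bases (contraction M)"
    and B': "(As' ! s - cls ` V) \<union> cls ` U \<in> bases (contraction M)"
  shows "(As ! r - U) \<union> V \<in> bases M" "(As ! s - V) \<union> U \<in> bases M"
    "basis_seq M m Bs" "compatible As Bs"
    "map ((`) cls) Bs
     = As'[r := (As' ! r - cls ` U) \<union> cls ` V, s := (As' ! s - cls ` V) \<union> cls ` U]"
proof -
  have A: "As ! r \<in> bases M" and B: "As ! s \<in> bases M"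
    using basis_seq_nth[OF As] rs As by (auto simp: basis_seq_def)
  have "As' ! r = cls ` (As ! r)" "As' ! s = cls ` (As ! s)"
    using rs by (simp_all add: As'_def)
  note lift = lift_subset_exchange[OF A B U V A'[unfolded this] B'[unfolded this]]
  show new: "(As ! r - U) \<union> V \<in> bases M" "(As ! s - V) \<union> U \<in> bases M" by (fact lift)+
  show "basis_seq M m Bs" unfolding Bs_def by (intro basis_seq_update2 As new)
  show "compatible As Bs" unfolding Bs_def using rs lift(3) by (intro compatible_update2) auto
  show "map ((`) cls) Bs
     = As'[r := (As' ! r - cls ` U) \<union> cls ` V, s := (As' ! s - cls ` V) \<union> cls ` U]"
    unfolding Bs_def As'_def by (rule project_subset_exchange(5)[OF As rs U V new])
qed

lemma project_sym_exchange:
  assumes As: "basis_seq M m As" and "sym_exchange M As Bs"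
  shows "sym_exchange (contraction M) (map ((`) cls) As) (map ((`) cls) Bs)"
proof -
  from assms(2) obtain r s x y where *: "r < s" "s < length As" "x \<in> As ! r" "y \<in> As ! s"
    "(As ! r - {x}) \<union> {y} \<in> bases M" "(As ! s - {y}) \<union> {x} \<in> bases M"
    and Bs: "Bs = As[r := (As ! r - {x}) \<union> {y}, s := (As ! s - {y}) \<union> {x}]"
    unfolding sym_exchange_def by blast
  have "{x} \<subseteq> As ! r" "{y} \<subseteq> As ! s" using * by auto
  note p = project_subset_exchange[OF As *(1,2) this *(5,6), unfolded image_insert image_empty]
  show ?thesis unfolding Bs p(5)
    using p(1-4) * by (intro sym_exchangeI[OF _ _ _ _ _ _ _ refl]) (simp_all del: nth_map)
qed

lemma project_sym_subset_exchange:
  assumes As: "basis_seq M m As" and "sym_subset_exchange M As Bs"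
  shows "sym_subset_exchange (contraction M) (map ((`) cls) As) (map ((`) cls) Bs)"
proof -
  from assms(2) obtain r s U V where *: "r < s" "s < length As" "U \<subseteq> As ! r" "V \<subseteq> As ! s"
    "(As ! r - U) \<union> V \<in> bases M" "(As ! s - V) \<union> U \<in> bases M"
    and Bs: "Bs = As[r := (As ! r - U) \<union> V, s := (As ! s - V) \<union> U]"
    unfolding sym_subset_exchange_def by blast
  note p = project_subset_exchange[OF As *]
  show ?thesis unfolding Bs p(5) sym_subset_exchange_def
    using p(1-4) *(1,2)
    by (intro exI[of _ r] exI[of _ s] exI[of _ "cls ` U"] exI[of _ "cls ` V"])
      (simp del: nth_map)
qed

lemma lift_sym_exchange:
  assumes As: "basis_seq M m As" and "sym_exchange (contraction M) (map ((`) cls) As) Cs"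
  shows "\<exists>Bs. basis_seq M m Bs \<and> sym_exchange M As Bs \<and> compatible As Bs \<and> map ((`) cls) Bs = Cs"
proof -
  let ?As = "map ((`) cls) As"
  from assms(2) obtain r s X Y where *: "r < s" "s < length As" "X \<in> ?As ! r" "Y \<in> ?As ! s"
    "(?As ! r - {X}) \<union> {Y} \<in> bases (contraction M)"
    "(?As ! s - {Y}) \<union> {X} \<in> bases (contraction M)"
    and Cs: "Cs = ?As[r := (?As ! r - {X}) \<union> {Y}, s := (?As ! s - {Y}) \<union> {X}]"
    unfolding sym_exchange_def length_map by blast
  from * have "X \<in> cls ` (As ! r)" "Y \<in> cls ` (As ! s)" by simp_all
  then obtain x y where xy: "x \<in> As ! r" "y \<in> As ! s" "X = cls x" "Y = cls y" by blast
  \<comment> \<open>Writing the singletons as images brings the exchange into the form of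
    \<open>lift_subset_exchange_seq\<close>.\<close>
  have "{X} = cls ` {x}" "{Y} = cls ` {y}" using xy by simp_all
  note * = *[unfolded this] and Cs = Cs[unfolded this]
  have "{x} \<subseteq> As ! r" "{y} \<subseteq> As ! s" using xy by auto
  note lift = lift_subset_exchange_seq[OF As *(1,2) this *(5,6)]
  have "sym_exchange M As (As[r := (As ! r - {x}) \<union> {y}, s := (As ! s - {y}) \<union> {x}])"
    using lift(1,2) xy *(1,2) by (intro sym_exchangeI[OF _ _ _ _ _ _ _ refl]) simp_all
  with lift(3-5) show ?thesis unfolding Cs by blast
qed

lemma lift_sym_subset_exchange:
  assumes As: "basis_seq M m As" and "sym_subset_exchange (contraction M) (map ((`) cls) As) Cs"
  shows "\<exists>Bs. basis_seq M m Bs \<and> sym_subset_exchange M As Bs \<and> compatible As Bs \<and>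
    map ((`) cls) Bs = Cs"
proof -
  let ?As = "map ((`) cls) As"
  from assms(2) obtain r s U' V' where *: "r < s" "s < length As" "U' \<subseteq> ?As ! r" "V' \<subseteq> ?As ! s"
    "(?As ! r - U') \<union> V' \<in> bases (contraction M)"
    "(?As ! s - V') \<union> U' \<in> bases (contraction M)"
    and Cs: "Cs = ?As[r := (?As ! r - U') \<union> V', s := (?As ! s - V') \<union> U']"
    unfolding sym_subset_exchange_def length_map by blast
  from * have "U' \<subseteq> cls ` (As ! r)" "V' \<subseteq> cls ` (As ! s)" by simp_all
  \<comment> \<open>The preimages are taken inside the bases, so \<open>U\<close> and
    \<open>V\<close> may themselves be exchanged.\<close>
  then obtain U V where UV: "U \<subseteq> As ! r" "V \<subseteq> As ! s" and eq: "U' = cls ` U" "V' = cls ` V"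
    unfolding subset_image_iff by blast
  note lift = lift_subset_exchange_seq[OF As *(1,2) UV *(5,6)[unfolded eq]]
  have "sym_subset_exchange M As (As[r := (As ! r - U) \<union> V, s := (As ! s - V) \<union> U])"
    using lift(1,2) UV *(1,2) unfolding sym_subset_exchange_def by blast
  with lift(3-5) show ?thesis unfolding Cs eq by blast
qed

lemma lift_sym_exchange_or_perm:
  assumes As: "basis_seq M m As" and "sym_exchange_or_perm (contraction M) (map ((`) cls) As) Cs"
  shows "\<exists>Bs. basis_seq M m Bs \<and> sym_exchange_or_perm M As Bs \<and> compatible As Bs \<and>
    map ((`) cls) Bs = Cs"
  using assms(2) unfolding sym_exchange_or_perm_def
proof
  assume "sym_exchange (contraction M) (map ((`) cls) As) Cs"
  from lift_sym_exchange[OF As this]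
  show "\<exists>Bs. basis_seq M m Bs \<and> (sym_exchange M As Bs \<or> mset As = mset Bs) \<and> compatible As Bs \<and>
    map ((`) cls) Bs = Cs" by blast
next
  assume "mset (map ((`) cls) As) = mset Cs"
  from mset_map_eq_lift[OF this] obtain Bs where Bs: "mset As = mset Bs" "map ((`) cls) Bs = Cs"
    by blast
  moreover have "basis_seq M m Bs"
    using As mset_eq_setD[OF Bs(1)] mset_eq_length[OF Bs(1)] by (simp add: basis_seq_def)
  ultimately show "\<exists>Bs. basis_seq M m Bs \<and> (sym_exchange M As Bs \<or> mset As = mset Bs) \<and>
    compatible As Bs \<and> map ((`) cls) Bs = Cs"
    using compatible_if_mset_eq by blast
qed

section \<open>Sequences with the same projection\<close>

text \<open>These are moves that the contraction does not see; they correct the choice of elements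
  within the classes.\<close>

lemma swap_equivalent:
  assumes As: "basis_seq M m As" and rs: "r < m" "s < m" "r \<noteq> s"
    and xy: "x \<in> As ! r" "y \<in> As ! s" "cls x = cls y"
  defines "Bs \<equiv> As[r := (As ! r - {x}) \<union> {y}, s := (As ! s - {y}) \<union> {x}]"
  shows "basis_seq M m Bs" "sym_exchange M As Bs" "compatible As Bs"
    "map ((`) cls) Bs = map ((`) cls) As"
proof -
  have len: "length As = m" using As by (simp add: basis_seq_def)
  have A: "As ! r \<in> bases M" and B: "As ! s \<in> bases M"
    using basis_seq_nth[OF As] rs by auto
  have gr: "x \<in> ground M" "y \<in> ground M" using basis_subset[OF M] A B xy by blast+
  have new: "(As ! r - {x}) \<union> {y} \<in> bases M" "(As ! s - {y}) \<union> {x} \<in> bases M"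
    using basis_replace_equivalent A B xy gr by metis+
  show "basis_seq M m Bs" unfolding Bs_def by (intro basis_seq_update2 As new)
  show "sym_exchange M As Bs"
    unfolding Bs_def using rs xy new len by (intro sym_exchangeI[OF _ _ _ _ _ _ _ refl]) auto
  have sub: "{x} \<subseteq> As ! r" "{y} \<subseteq> As ! s" using xy by auto
  show "compatible As Bs" unfolding Bs_def using rs len A B sub
    by (intro compatible_update2 mset_set_exchange finite_basis[OF M]
        exchange_disjoint[OF M A B sub new]) auto
  have eq: "cls ` ((As ! r - {x}) \<union> {y}) = cls ` (As ! r)" "cls ` ((As ! s - {y}) \<union> {x}) = cls ` (As ! s)"
    unfolding cls_image_exchange[OF A sub(1)] cls_image_exchange[OF B sub(2)]
      image_insert image_empty using xy by blast+
  show "map ((`) cls) Bs = map ((`) cls) As"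
    unfolding Bs_def map_update eq using rs len
    by (intro nth_equalityI) (auto simp: nth_list_update)
qed

text \<open>Induction on the total number of elements of \<open>As\<close> that are misplaced with
  respect to \<open>Bs\<close>. If \<open>x\<close> is missing at position \<open>r\<close>, an
  equivalent \<open>y\<close> stands there instead, and compatibility provides a position
  \<open>s\<close> with a surplus \<open>x\<close>; swapping the two lowers the total.\<close>

lemma connected_if_same_classes:
  assumes "basis_seq M m As" and Bs: "basis_seq M m Bs" and "compatible As Bs"
    and "map ((`) cls) As = map ((`) cls) Bs"
  shows "(\<lambda>Xs Ys. basis_seq M m Xs \<and> basis_seq M m Ys \<and> sym_exchange M Xs Ys)\<^sup>*\<^sup>* As Bs"
  using assms(1,3,4)
proof (induction "\<Sum>i<m. card (As ! i - Bs ! i)" arbitrary: As rule: less_induct)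
  case less
  note As = less.prems(1)
  have len: "length As = m" "length Bs = m" using As Bs by (auto simp: basis_seq_def)
  have fin: "finite A" if "A \<in> set As \<union> set Bs" for A
    using that As Bs finite_basis[OF M] by (auto simp: basis_seq_def)
  have same: "cls ` (As ! i) = cls ` (Bs ! i)" if "i < m" for i
    using arg_cong[OF less.prems(3), of "\<lambda>Xs. Xs ! i"] that len by simp
  show ?case
  proof (cases "As = Bs")
    case True
    then show ?thesis by simp
  next
    case False
    then obtain r where r: "r < m" "As ! r \<noteq> Bs ! r" using len nth_equalityI by metis
    have Ar: "As ! r \<in> bases M" and Br: "Bs ! r \<in> bases M"
      using basis_seq_nth As Bs r by auto
    have "\<not> Bs ! r \<subseteq> As ! r"
    proof
      assume "Bs ! r \<subseteq> As ! r"
      then have "Bs ! r = As ! r"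
        using card_bases_eq[OF M Br Ar] finite_basis[OF M Ar] card_subset_eq by metis
      with r show False by simp
    qed
    then obtain x where x: "x \<in> Bs ! r - As ! r" by blast
    then have "cls x \<in> cls ` (As ! r)" unfolding same[OF r(1)] by blast
    then obtain y where "cls x = cls y" "y \<in> As ! r" by (rule imageE)
    then have y: "y \<in> As ! r" "cls y = cls x" by simp_all
    \<comment> \<open>Otherwise the basis \<open>Bs ! r\<close> would contain the equivalent
      elements \<open>x\<close> and \<open>y\<close>, so \<open>x = y\<close> would lie in
      \<open>As ! r\<close>.\<close>
    have "y \<notin> Bs ! r" using inj_onD[OF inj_on_cls[OF Br] y(2)] x y(1) by blast
    obtain s where s: "s < m" "x \<in> As ! s - Bs ! s"
      using compatible_missing_elem[of As Bs r x] less.prems(2) len fin r(1) x by metis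
    have "r \<noteq> s" using x s by auto
    let ?Cs = "As[r := (As ! r - {y}) \<union> {x}, s := (As ! s - {x}) \<union> {y}]"
    note swap = swap_equivalent[OF As r(1) s(1) \<open>r \<noteq> s\<close> y(1) DiffD1[OF s(2)] y(2)]
    have fin': "finite (As ! i)" if "i < m" for i using that fin len by auto
    have "(\<Sum>i<m. card (?Cs ! i - Bs ! i)) < (\<Sum>i<m. card (As ! i - Bs ! i))"
    proof (rule sum_strict_mono_ex1)
      have at_r: "?Cs ! r - Bs ! r = (As ! r - Bs ! r) - {y}"
        using x r(1) len \<open>r \<noteq> s\<close> by auto
      have "card (?Cs ! r - Bs ! r) < card (As ! r - Bs ! r)"
        unfolding at_r using y(1) \<open>y \<notin> Bs ! r\<close> fin' r(1) by (intro card_Diff1_less) auto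
      then show "\<exists>i\<in>{..<m}. card (?Cs ! i - Bs ! i) < card (As ! i - Bs ! i)"
        using r(1) by blast
      \<comment> \<open>At \<open>s\<close> the arriving \<open>y\<close> may be misplaced, but the
        misplaced \<open>x\<close> leaves, so the number there does not grow.\<close>
      have "card (?Cs ! s - Bs ! s) \<le> card (insert y ((As ! s - Bs ! s) - {x}))"
        using s len fin' by (intro card_mono) auto
      also have "\<dots> \<le> Suc (card ((As ! s - Bs ! s) - {x}))" by (rule card_insert_le_m1) auto
      also have "\<dots> = card (As ! s - Bs ! s)" using s fin' by (intro card_Suc_Diff1) auto
      finally have at_s: "card (?Cs ! s - Bs ! s) \<le> card (As ! s - Bs ! s)" .
      show "\<forall>i\<in>{..<m}. card (?Cs ! i - Bs ! i) \<le> card (As ! i - Bs ! i)"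
      proof
        fix i
        consider "i = r" | "i = s" | "i \<noteq> r" "i \<noteq> s" by blast
        then show "card (?Cs ! i - Bs ! i) \<le> card (As ! i - Bs ! i)"
          using \<open>card (?Cs ! r - Bs ! r) < _\<close> at_s by cases auto
      qed
    qed simp
    moreover have "compatible ?Cs Bs"
      by (rule compatible_trans[OF compatible_sym[OF swap(3)] less.prems(2)])
    moreover have "map ((`) cls) ?Cs = map ((`) cls) Bs" by (rule trans[OF swap(4) less.prems(3)])
    ultimately have "(\<lambda>Xs Ys. basis_seq M m Xs \<and> basis_seq M m Ys \<and> sym_exchange M Xs Ys)\<^sup>*\<^sup>* ?Cs Bs"
      by (intro less.hyps swap(1))
    then show ?thesis
      by (rule converse_rtranclp_into_rtranclp[rotated]) (intro conjI As swap(1,2))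
  qed
qed

section \<open>Transfer of connectedness between \<open>M\<close> and its contraction\<close>

lemma basis_seq_project: "basis_seq M m As \<Longrightarrow> basis_seq (contraction M) m (map ((`) cls) As)"
  unfolding basis_seq_def bases_contraction by auto

text \<open>Sequences of the contraction are embedded into \<open>M\<close> by representatives,
  connected there, and the chain is projected back. The relations \<open>step\<close> and
  \<open>step'\<close> are separate variables because they live on different element types.\<close>

lemma TE_contraction_if_TE:
  assumes TE: "M \<in> TE step"
    and project: "\<And>m As Bs. basis_seq M m As \<Longrightarrow> step M As Bs \<Longrightarrow>
      step' (contraction M) (map ((`) cls) As) (map ((`) cls) Bs)"
  shows "contraction M \<in> TE step'"
proof -
  have "(\<lambda>Xs Ys. basis_seq (contraction M) m Xs \<and> basis_seq (contraction M) m Ys \<and>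
      step' (contraction M) Xs Ys)\<^sup>*\<^sup>* As' Bs'"
    if m: "m \<ge> 1" and As': "basis_seq (contraction M) m As'" and Bs': "basis_seq (contraction M) m Bs'"
      and comp: "compatible As' Bs'" for m As' Bs'
  proof -
    \<comment> \<open>A single choice for all bases: \<open>rep\<close> must not depend on the
      basis, or compatibility could be lost.\<close>
    define rep where "rep Y = (SOME x. x \<in> ground M \<and> cls x = Y)" for Y
    have rep: "rep Y \<in> ground M \<and> cls (rep Y) = Y" if "Y \<in> ground (contraction M)" for Y
    proof -
      have "\<exists>x. x \<in> ground M \<and> cls x = Y"
        using that unfolding contraction_def quotient_def by auto
      then show ?thesis unfolding rep_def by (rule someI_ex)
    qed
    note gr = basis_subset[OF matroid_contraction[OF M]]
    have inj: "inj_on rep A" if "A \<in> bases (contraction M)" for A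
      using rep gr[OF that] by (intro inj_on_inverseI[of _ "cls"]) blast
    have cls_rep: "cls ` rep ` A = A" if "A \<in> bases (contraction M)" for A
    proof -
      have "(\<lambda>Y. cls (rep Y)) ` A = (\<lambda>Y. Y) ` A"
        using rep gr[OF that] by (intro image_cong) blast+
      then show ?thesis unfolding image_image by simp
    qed
    have basis: "rep ` A \<in> bases M" if A: "A \<in> bases (contraction M)" for A
    proof (rule transversal_basis)
      show "rep ` A \<subseteq> ground M" using rep gr[OF A] by blast
      show "inj_on cls (rep ` A)"
        using rep gr[OF A] by (intro inj_on_inverseI[of _ rep]) (metis imageE subsetD)
      show "cls ` rep ` A \<in> bases (contraction M)" unfolding cls_rep[OF A] by (rule A)
    qed
    have seq: "basis_seq M m (map ((`) rep) Xs)" if "basis_seq (contraction M) m Xs" for Xs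
      using that basis unfolding basis_seq_def by auto
    have id: "map ((`) cls) (map ((`) rep) Xs) = Xs" if "basis_seq (contraction M) m Xs" for Xs
      unfolding map_map using that cls_rep unfolding basis_seq_def
      by (intro map_idI) (auto simp: subset_iff)
    have "compatible (map ((`) rep) As') (map ((`) rep) Bs')"
      using comp inj As' Bs' by (intro compatible_map_image) (auto simp: basis_seq_def)
    then have "(\<lambda>Xs Ys. basis_seq M m Xs \<and> basis_seq M m Ys \<and> step M Xs Ys)\<^sup>*\<^sup>*
        (map ((`) rep) As') (map ((`) rep) Bs')"
      using TE m seq[OF As'] seq[OF Bs'] unfolding TE_def by blast
    then have "(\<lambda>Xs Ys. basis_seq (contraction M) m Xs \<and> basis_seq (contraction M) m Ys \<and>
        step' (contraction M) Xs Ys)\<^sup>*\<^sup>*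
        (map ((`) cls) (map ((`) rep) As')) (map ((`) cls) (map ((`) rep) Bs'))"
    proof induction
      case base
      show ?case by (rule rtranclp.rtrancl_refl)
    next
      case (step Ys Zs)
      from step.IH show ?case
        by (rule rtranclp.rtrancl_into_rtrancl) (use step.hyps(2) project basis_seq_project in blast)
    qed
    then show ?thesis unfolding id[OF As'] id[OF Bs'] .
  qed
  then show ?thesis using matroid_contraction[OF M] unfolding TE_def by blast
qed

text \<open>A chain between the projections is lifted step by step from \<open>As\<close>. Its end
  has the classes of \<open>Bs\<close> but perhaps other elements, which swaps of equivalent
  elements repair; the hypothesis \<open>swap\<close> admits these as steps.\<close>

lemma TE_if_TE_contraction:
  assumes TE: "contraction M \<in> TE step'"
    and lift: "\<And>m As Cs. basis_seq M m As \<Longrightarrow> step' (contraction M) (map ((`) cls) As) Cs \<Longrightarrow>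
      \<exists>Bs. basis_seq M m Bs \<and> step M As Bs \<and> compatible As Bs \<and> map ((`) cls) Bs = Cs"
    and swap: "\<And>As Bs. sym_exchange M As Bs \<Longrightarrow> step M As Bs"
  shows "M \<in> TE step"
proof -
  have "(\<lambda>Xs Ys. basis_seq M m Xs \<and> basis_seq M m Ys \<and> step M Xs Ys)\<^sup>*\<^sup>* As Bs"
    if m: "m \<ge> 1" and As: "basis_seq M m As" and Bs: "basis_seq M m Bs" and comp: "compatible As Bs"
    for m As Bs
  proof -
    let ?S = "\<lambda>Xs Ys. basis_seq M m Xs \<and> basis_seq M m Ys \<and> step M Xs Ys"
    have "compatible (map ((`) cls) As) (map ((`) cls) Bs)"
      using comp inj_on_cls As Bs by (intro compatible_map_image) (auto simp: basis_seq_def)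
    then have "(\<lambda>Xs Ys. basis_seq (contraction M) m Xs \<and> basis_seq (contraction M) m Ys \<and>
        step' (contraction M) Xs Ys)\<^sup>*\<^sup>* (map ((`) cls) As) (map ((`) cls) Bs)"
      using TE m basis_seq_project[OF As] basis_seq_project[OF Bs] unfolding TE_def by blast
    \<comment> \<open>Compatibility with \<open>As\<close> is carried along the chain, since the
      final swaps need the lifted end to be compatible with \<open>Bs\<close>.\<close>
    then have "\<exists>Cs. basis_seq M m Cs \<and> compatible As Cs \<and> ?S\<^sup>*\<^sup>* As Cs \<and>
        map ((`) cls) Cs = map ((`) cls) Bs"
    proof induction
      case base
      show ?case using As by (auto simp: compatible_def)
    next
      case (step Ys Zs)
      from step.IH obtain Cs where Cs: "basis_seq M m Cs" "compatible As Cs" "?S\<^sup>*\<^sup>* As Cs"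
        "map ((`) cls) Cs = Ys" by blast
      with lift[of m Cs Zs] step.hyps(2) obtain Ds where Ds: "basis_seq M m Ds" "step M Cs Ds"
        "compatible Cs Ds" "map ((`) cls) Ds = Zs" by blast
      have "?S\<^sup>*\<^sup>* As Ds"
        using Cs(3) by (rule rtranclp.rtrancl_into_rtrancl) (use Cs Ds in blast)
      with Cs Ds compatible_trans show ?case by blast
    qed
    then obtain Cs where Cs: "basis_seq M m Cs" "compatible As Cs" "?S\<^sup>*\<^sup>* As Cs"
      "map ((`) cls) Cs = map ((`) cls) Bs" by blast
    then have "compatible Cs Bs" using comp compatible_trans compatible_sym by blast
    from connected_if_same_classes[OF Cs(1) Bs this Cs(4)] have "?S\<^sup>*\<^sup>* Cs Bs"
      by (rule rtranclp_mono[THEN predicate2D, rotated]) (use swap in blast)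
    with Cs(3) show ?thesis by (rule rtranclp_trans)
  qed
  then show ?thesis using M unfolding TE_def by blast
qed

section \<open>The equivalence for each of the three kinds of step\<close>

lemma TE_sym_exchange_iff: "M \<in> TE sym_exchange \<longleftrightarrow> contraction M \<in> TE sym_exchange"
proof
  assume "M \<in> TE sym_exchange"
  then show "contraction M \<in> TE sym_exchange"
    by (rule TE_contraction_if_TE) (rule project_sym_exchange)
next
  assume "contraction M \<in> TE sym_exchange"
  then show "M \<in> TE sym_exchange"
    by (rule TE_if_TE_contraction) (rule lift_sym_exchange, assumption, assumption)
qed

lemma TE_sym_exchange_or_perm_iff:
  "M \<in> TE sym_exchange_or_perm \<longleftrightarrow> contraction M \<in> TE sym_exchange_or_perm"
proof
  assume "M \<in> TE sym_exchange_or_perm"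
  then show "contraction M \<in> TE sym_exchange_or_perm"
  proof (rule TE_contraction_if_TE)
    fix m As Bs assume "basis_seq M m As" "sym_exchange_or_perm M As Bs"
    then show "sym_exchange_or_perm (contraction M) (map ((`) cls) As) (map ((`) cls) Bs)"
      using project_sym_exchange unfolding sym_exchange_or_perm_def mset_map by metis
  qed
next
  assume "contraction M \<in> TE sym_exchange_or_perm"
  then show "M \<in> TE sym_exchange_or_perm"
    by (rule TE_if_TE_contraction)
      (rule lift_sym_exchange_or_perm, assumption+, simp add: sym_exchange_or_perm_def)
qed

lemma TE_sym_subset_exchange_iff:
  "M \<in> TE sym_subset_exchange \<longleftrightarrow> contraction M \<in> TE sym_subset_exchange"
proof
  assume "M \<in> TE sym_subset_exchange"
  then show "contraction M \<in> TE sym_subset_exchange"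
    by (rule TE_contraction_if_TE) (rule project_sym_subset_exchange)
next
  assume "contraction M \<in> TE sym_subset_exchange"
  then show "M \<in> TE sym_subset_exchange"
    by (rule TE_if_TE_contraction) (rule lift_sym_subset_exchange, assumption+, rule sym_exchange_imp_subset)
qed

end

theorem corollary3p11:
  fixes M :: "'a basis_system"
  assumes "matroid M"
  shows "satisfies_white M \<longleftrightarrow> satisfies_white (contraction M)"
  unfolding satisfies_white_def TE_sym_exchange_iff[OF assms]
    TE_sym_exchange_or_perm_iff[OF assms] TE_sym_subset_exchange_iff[OF assms] ..

end
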